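(* Let $X=[x_0,x_{max}]\subset\mathbb{R}$, $Y=[y_0,y_{max}]^2\subset\mathbb{R}^2$, and let $c,f,g$ satisfy hypotheses (H1)--(H4) listed in the context. Let $N,M\in\mathbb{N}$, $h_X=(x_{max}-x_0)/N$, $h_Y=(y_{max}-y_0)/M$. Then the approximation scheme $F^{h_X,h_Y}=(F^{h_X,h_Y}_i)_{i=0}^N$ defined in the context is monotone. That is, for $i=1,\dots,N-1$, the function $F_i^{h_X,h_Y}(u_i,u_i-u_{i-1},u_i-u_{i+1})$ is non-decreasing in each of its three arguments. Likewise, $F_0^{h_X,h_Y}(u_0,u_0-u_1)$ and $F_N^{h_X,h_Y}(u_N,u_N-u_{N-1})$ are non-decreasing in each of their two arguments.
   Context: **Problem.** $X=[x_0,x_{max}]\subset\mathbb{R}$ and $Y=[y_0,y_{max}]^2\subset\mathbb{R}^2$. A cost function is $c:X\times Y\to\mathbb{R}$, written $c(x,y)$ with $y=(y_1,y_2)$. The densities $f$ on $X$ and $g$ on $Y$ satisfy $\int_X f\,dx=\int_Y g\,dy$. Write $t^+=\max\{t,0\}$. The equation for $u:X\to\mathbb{R}$ is $$-\int_{Y}\left(u''(x)+\frac{\partial^2c}{\partial x^2}(x,y)\right)^+\psi(x,y)\,\delta\!\left(u'(x)+\frac{\partial c}{\partial x}(x,y)\right)dy+f(x)=0,\qquad(\ast)$$ where $$\psi(x,y)=\frac{g(y)\,\left|\nabla_y\frac{\partial c}{\partial x}(x,y)\right|}{\sqrt{\left(\frac{\partial^2c}{\partial x\partial y_1}(x,y)\right)^2+\left(\frac{\partial^2c}{\partial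 x\partial y_2}(x,y)\right)^2}}.$$ Here $\delta$ is the Dirac delta, and for a level set function $\phi$ with non-vanishing gradient, $\int_Y r(y)\delta(\phi(y))\,dy=\int_{\{y\in Y:\phi(y)=0\}}\frac{r(y)}{|\nabla\phi(y)|}\,dH_1(y)$, with $H_1$ the one-dimensional Hausdorff measure. **Hypotheses.** - (H1) $c\in C^4(\bar X\times\bar Y)$. - (H2) $\sqrt{\left(\frac{\partial^2c}{\partial x\partial y_1}\right)^2+\left(\frac{\partial^2c}{\partial x\partial y_2}\right)^2}$ is bounded away from zero. - (H3) The positive densities $f\in C^0(\bar X)$ and $g\in C^2(\bar Y)$ are bounded away from zero and infinity. - (H4) The solution $u$ of $(\ast)$ is in $C^2(X)\cap C^1(\bar X)$. **Grids.** $x_i=x_0+ih_X$ for $i=0,\dots,N$, and $y_{jk}=(y_0+jh_Y,\,y_0+kh_Y)$ for $j,k=0,\dots,M$. For a grid function, $u_i=u(x_i)$. **Scheme.** For $i=1,\dots,N-1$, $$F_i^{h_X,h_Y}(u_i,u_i-u_{i-1},u_i-u_{i+1})=-h_Y^2\sum_{j=0}^M\sum_{k=0}^M\left(\mathcal{D}^{h_X}_{xx}u_i+\frac{\partial^2c}{\partial x^2}(x_i,y_{jk})\right)^+\psi(x_i,y_{jk})\,\delta^{h_X,h_Y}_{i,jk}+f(x_i)+\left(h_Y^2+\frac{h_X}{h_Y}\right)u_i,$$ with $$\mathcal{D}^{h_X}_{xx}u_i=\frac{(u_{i-1}-u_i)+(u_{i+1}-u_i)}{h_X^2},$$ $$\delta^{h_X,h_Y}_{i,jk}=\frac1\epsilon\max\left\{1-\frac1\epsilon\max\left\{\frac{u_i-u_{i-1}}{h_X}+\frac{\partial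 c}{\partial x}(x_i,y_{jk}),\,-\frac{u_{i+1}-u_i}{h_X}-\frac{\partial c}{\partial x}(x_i,y_{jk}),\,0\right\},0\right\},$$ $$\epsilon=h_Y\max\left\{\left\|\nabla_y\frac{\partial c}{\partial x}(x_i,y)\right\|_{L^1(Y)},1\right\}.$$ At the boundary points, $$F_0^{h_X,h_Y}(u_0,u_0-u_1)=-\frac{u_1-u_0}{h_X}+\inf_{y\in Y}\left\{-\frac{\partial c}{\partial x}(x_0,y)\right\}+h_Xu_0,$$ $$F_N^{h_X,h_Y}(u_N,u_N-u_{N-1})=\frac{u_N-u_{N-1}}{h_X}-\sup_{y\in Y}\left\{-\frac{\partial c}{\partial x}(x_N,y)\right\}+h_Xu_N.$$ **Monotonicity.** A scheme $F^h(x,u(x),u(x)-u(\cdot))$ is monotone if $F^h$ is a non-decreasing function of its final two arguments, i.e. of $u(x)$ and of each of the differences $u(x)-u(\cdot)$. *)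

theory Defs
  imports "HOL-Analysis.Analysis"
begin

(* The derivative is taken within S, so it is one-sided at boundary points of a closed box;
   for C^k functions on a nondegenerate closed box this is the continuous extension of the
   interior partial derivative. *)
definition partial_deriv :: "'a::euclidean_space set \<Rightarrow> 'a \<Rightarrow> ('a \<Rightarrow> real) \<Rightarrow> 'a \<Rightarrow> real" where
  "partial_deriv S b F p =
     vector_derivative (\<lambda>t. F (p + t *\<^sub>R b)) (at 0 within {t. p + t *\<^sub>R b \<in> S})"

definition grad_on :: "'a::euclidean_space set \<Rightarrow> ('a \<Rightarrow> real) \<Rightarrow> 'a \<Rightarrow> 'a" where
  "grad_on S F p = (\<Sum>b\<in>Basis. partial_deriv S b F p *\<^sub>R b)"

primrec Ck_on :: "nat \<Rightarrow> 'a::euclidean_space set \<Rightarrow> ('a \<Rightarrow> real) \<Rightarrow> bool" where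
  "Ck_on 0 S F \<longleftrightarrow> continuous_on S F"
| "Ck_on (Suc k) S F \<longleftrightarrow> continuous_on S F \<and>
     (\<forall>b\<in>Basis.
        (\<forall>p\<in>S. (\<lambda>t. F (p + t *\<^sub>R b)) differentiable (at 0 within {t. p + t *\<^sub>R b \<in> S})) \<and>
        Ck_on k S (partial_deriv S b F))"

(* Covers are required to be bounded because the library's diameter is unspecified on
   unbounded sets. *)
definition hausdorff1_outer :: "'a::metric_space set \<Rightarrow> ennreal" where
  "hausdorff1_outer A =
     (SUP d\<in>{0<..}. INF U\<in>{U :: nat \<Rightarrow> 'a set.
        A \<subseteq> (\<Union>n. U n) \<and> (\<forall>n. bounded (U n) \<and> diameter (U n) \<le> d)}.
        (\<Sum>n. ennreal (diameter (U n))))"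

(* A metric outer measure, hence countably additive on the Borel sets, so that measure_of
   keeps the values of hausdorff1_outer there. *)
definition hausdorff1 :: "'a::metric_space measure" where
  "hausdorff1 = measure_of UNIV (sets borel) hausdorff1_outer"

(* The integral of r(y) delta(phi(y)) over Y, by the co-area formula. *)
definition delta_integral ::
  "(real \<times> real) set \<Rightarrow> (real \<times> real \<Rightarrow> real) \<Rightarrow> (real \<times> real \<Rightarrow> real) \<Rightarrow> real" where
  "delta_integral Y r \<phi> =
     (LINT y:{y \<in> Y. \<phi> y = 0}|hausdorff1. r y / norm (grad_on Y \<phi> y))"

type_synonym cost = "real \<times> (real \<times> real) \<Rightarrow> real"

definition c_x :: "real set \<Rightarrow> (real \<times> real) set \<Rightarrow> cost \<Rightarrow> cost" where
  "c_x X Y c = partial_deriv (X \<times> Y) (1, (0, 0)) c"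

definition c_xx :: "real set \<Rightarrow> (real \<times> real) set \<Rightarrow> cost \<Rightarrow> cost" where
  "c_xx X Y c = partial_deriv (X \<times> Y) (1, (0, 0)) (c_x X Y c)"

definition c_xy1 :: "real set \<Rightarrow> (real \<times> real) set \<Rightarrow> cost \<Rightarrow> cost" where
  "c_xy1 X Y c = partial_deriv (X \<times> Y) (0, (1, 0)) (c_x X Y c)"

definition c_xy2 :: "real set \<Rightarrow> (real \<times> real) set \<Rightarrow> cost \<Rightarrow> cost" where
  "c_xy2 X Y c = partial_deriv (X \<times> Y) (0, (0, 1)) (c_x X Y c)"

definition grad_y_c_x ::
  "real set \<Rightarrow> (real \<times> real) set \<Rightarrow> cost \<Rightarrow> real \<Rightarrow> real \<times> real \<Rightarrow> real \<times> real" where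
  "grad_y_c_x X Y c x y = grad_on Y (\<lambda>z. c_x X Y c (x, z)) y"

definition psi ::
  "real set \<Rightarrow> (real \<times> real) set \<Rightarrow> cost \<Rightarrow> (real \<times> real \<Rightarrow> real) \<Rightarrow> real \<Rightarrow> real \<times> real \<Rightarrow> real" where
  "psi X Y c g x y =
     g y * norm (grad_y_c_x X Y c x y) /
     sqrt ((c_xy1 X Y c (x, y))\<^sup>2 + (c_xy2 X Y c (x, y))\<^sup>2)"

definition solves_equation ::
  "real set \<Rightarrow> (real \<times> real) set \<Rightarrow> cost \<Rightarrow> (real \<Rightarrow> real) \<Rightarrow> (real \<times> real \<Rightarrow> real) \<Rightarrow>
   (real \<Rightarrow> real) \<Rightarrow> bool" where
  "solves_equation X Y c f g u \<longleftrightarrow>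
     (\<forall>x\<in>interior X.
        - delta_integral Y
            (\<lambda>y. max (deriv (deriv u) x + c_xx X Y c (x, y)) 0 * psi X Y c g x y)
            (\<lambda>y. deriv u x + c_x X Y c (x, y))
        + f x = 0)"

definition D_xx :: "real \<Rightarrow> real \<Rightarrow> real \<Rightarrow> real \<Rightarrow> real" where
  "D_xx hX ul uc ur = ((ul - uc) + (ur - uc)) / hX\<^sup>2"

definition delta_width ::
  "real set \<Rightarrow> (real \<times> real) set \<Rightarrow> cost \<Rightarrow> real \<Rightarrow> real \<Rightarrow> real" where
  "delta_width X Y c hY x =
     hY * max (LINT y:Y|lborel. norm (grad_y_c_x X Y c x y)) 1"

definition delta_h ::
  "real set \<Rightarrow> (real \<times> real) set \<Rightarrow> cost \<Rightarrow> real \<Rightarrow> real \<Rightarrow>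
   real \<Rightarrow> real \<times> real \<Rightarrow> real \<Rightarrow> real \<Rightarrow> real \<Rightarrow> real" where
  "delta_h X Y c hX hY x y ul uc ur =
     (let \<epsilon> = delta_width X Y c hY x in
      1 / \<epsilon> * max (1 - 1 / \<epsilon> * max (max ((uc - ul) / hX + c_x X Y c (x, y))
                                         (- ((ur - uc) / hX) - c_x X Y c (x, y))) 0) 0)"

definition x_grid :: "real \<Rightarrow> real \<Rightarrow> nat \<Rightarrow> real" where
  "x_grid x0 hX i = x0 + real i * hX"

definition y_grid :: "real \<Rightarrow> real \<Rightarrow> nat \<Rightarrow> nat \<Rightarrow> real \<times> real" where
  "y_grid y0 hY j k = (y0 + real j * hY, y0 + real k * hY)"

(* In the schemes below, a stands for the value u_i, and p, q for the differences
   u_i - u_(i-1), u_i - u_(i+1) (interior) or for the one available difference (boundary).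
   The neighbouring values entering the formulas are therefore a - p and a - q. *)

definition F_interior ::
  "real set \<Rightarrow> (real \<times> real) set \<Rightarrow> cost \<Rightarrow> (real \<Rightarrow> real) \<Rightarrow> (real \<times> real \<Rightarrow> real) \<Rightarrow>
   real \<Rightarrow> real \<Rightarrow> real \<Rightarrow> real \<Rightarrow> nat \<Rightarrow> nat \<Rightarrow> real \<Rightarrow> real \<Rightarrow> real \<Rightarrow> real" where
  "F_interior X Y c f g x0 y0 hX hY M i a p q =
     (let xi = x_grid x0 hX i; ul = a - p; uc = a; ur = a - q in
      - hY\<^sup>2 * (\<Sum>j=0..M. \<Sum>k=0..M.
          let y = y_grid y0 hY j k in
          max (D_xx hX ul uc ur + c_xx X Y c (xi, y)) 0 * psi X Y c g xi y *
          delta_h X Y c hX hY xi y ul uc ur)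
      + f xi + (hY\<^sup>2 + hX / hY) * uc)"

definition F_left ::
  "real set \<Rightarrow> (real \<times> real) set \<Rightarrow> cost \<Rightarrow> real \<Rightarrow> real \<Rightarrow> real \<Rightarrow> real \<Rightarrow> real" where
  "F_left X Y c x0 hX a p =
     (let u0 = a; u1 = a - p in
      - ((u1 - u0) / hX) + (INF y\<in>Y. - c_x X Y c (x_grid x0 hX 0, y)) + hX * u0)"

definition F_right ::
  "real set \<Rightarrow> (real \<times> real) set \<Rightarrow> cost \<Rightarrow> real \<Rightarrow> real \<Rightarrow> nat \<Rightarrow> real \<Rightarrow> real \<Rightarrow> real" where
  "F_right X Y c x0 hX N a p =
     (let uN = a; uN1 = a - p in
      (uN - uN1) / hX - (SUP y\<in>Y. - c_x X Y c (x_grid x0 hX N, y)) + hX * uN)"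

(* The whole scheme in the form F(x_i, u_i, u_i - u(.)): d k stands for u_i - u_k. *)
definition F_scheme ::
  "real set \<Rightarrow> (real \<times> real) set \<Rightarrow> cost \<Rightarrow> (real \<Rightarrow> real) \<Rightarrow> (real \<times> real \<Rightarrow> real) \<Rightarrow>
   real \<Rightarrow> real \<Rightarrow> real \<Rightarrow> real \<Rightarrow> nat \<Rightarrow> nat \<Rightarrow> nat \<Rightarrow> real \<Rightarrow> (nat \<Rightarrow> real) \<Rightarrow> real" where
  "F_scheme X Y c f g x0 y0 hX hY N M i a d =
     (if i = 0 then F_left X Y c x0 hX a (d 1)
      else if i = N then F_right X Y c x0 hX N a (d (N - 1))
      else F_interior X Y c f g x0 y0 hX hY M i a (d (i - 1)) (d (i + 1)))"

definition monotone_scheme ::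
  "nat set \<Rightarrow> (nat \<Rightarrow> real \<Rightarrow> (nat \<Rightarrow> real) \<Rightarrow> real) \<Rightarrow> bool" where
  "monotone_scheme I F \<longleftrightarrow>
     (\<forall>i\<in>I. (\<forall>d. mono (\<lambda>a. F i a d)) \<and>
            (\<forall>a d k. mono (\<lambda>t. F i a (d(k := t)))))"

end

theory Submission
  imports Defs
begin

text \<open>Written in the differences \<open>p = u\<^sub>i - u\<^sub>i\<^sub>-\<^sub>1\<close> and \<open>q = u\<^sub>i - u\<^sub>i\<^sub>+\<^sub>1\<close>, the discrete second derivative is
  \<open>- (p + q) / h\<^sub>X\<^sup>2\<close>, and the smoothed delta is a non-increasing function of
  \<open>max (p / h\<^sub>X + c\<^sub>x) (q / h\<^sub>X - c\<^sub>x)\<close>. Both are therefore non-increasing in \<open>p\<close> and \<open>q\<close>, and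
  neither depends on \<open>u\<^sub>i\<close> itself. In each summand of the quadrature the positive part of the first
  and the second are non-negative, so their product is non-increasing too (\<open>quadrature_term_antimono\<close>);
  multiplying by the weight \<open>\<psi>\<close>, non-negative because the grid points lie in \<open>Y\<close> (\<open>y_grid_in_square\<close>)
  where \<open>g > 0\<close>, preserves this and the minus sign in front of the sum
  reverses it. What is left depends on \<open>u\<^sub>i\<close> alone, through the term
  \<open>(h\<^sub>Y\<^sup>2 + h\<^sub>X / h\<^sub>Y) u\<^sub>i\<close> with positive coefficient. At the two boundary points the scheme is affine in
  its arguments, with positive coefficients \<open>h\<^sub>X\<close> and \<open>1 / h\<^sub>X\<close>.

  Monotonicity is proved jointly in all arguments, from which monotonicity in each single
  argument, and for the scheme as a whole, follows by keeping the other arguments equal.\<close>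

lemma delta_width_nonneg:
  assumes "0 \<le> hY"
  shows "0 \<le> delta_width X Y c hY x"
  unfolding delta_width_def using assms by (intro mult_nonneg_nonneg) auto

lemma delta_h_nonneg:
  assumes "0 \<le> hY"
  shows "0 \<le> delta_h X Y c hX hY x y ul uc ur"
  unfolding delta_h_def Let_def
  using delta_width_nonneg[OF assms] by (intro mult_nonneg_nonneg) auto

lemma delta_h_antimono:
  assumes "0 \<le> hX" and "0 \<le> hY" and "p \<le> p'" and "q \<le> q'"
  shows "delta_h X Y c hX hY x y (a' - p') a' (a' - q')
       \<le> delta_h X Y c hX hY x y (a - p) a (a - q)"
proof -
  define w where "w = 1 / delta_width X Y c hY x"
  define slope where
    "slope = (\<lambda>p q. max (max (p / hX + c_x X Y c (x, y)) (q / hX - c_x X Y c (x, y))) 0)"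
  have "0 \<le> w"
    using delta_width_nonneg[OF assms(2)] by (simp add: w_def)
  have "p / hX \<le> p' / hX" "q / hX \<le> q' / hX"
    using assms by (auto intro: divide_right_mono)
  then have "slope p q \<le> slope p' q'"
    unfolding slope_def by (intro max.mono) auto
  then have "w * slope p q \<le> w * slope p' q'"
    using \<open>0 \<le> w\<close> by (rule mult_left_mono)
  then have "w * max (1 - w * slope p' q') 0 \<le> w * max (1 - w * slope p q) 0"
    using \<open>0 \<le> w\<close> by (intro mult_left_mono max.mono) auto
  moreover have "delta_h X Y c hX hY x y (b - r) b (b - s) = w * max (1 - w * slope r s) 0"
    for b r s
    by (simp add: delta_h_def Let_def w_def slope_def)
  ultimately show ?thesis
    by simp
qed

lemma D_xx_antimono:
  assumes "p \<le> p'" and "q \<le> q'"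
  shows "D_xx hX (a' - p') a' (a' - q') \<le> D_xx hX (a - p) a (a - q)"
  unfolding D_xx_def using assms by (intro divide_right_mono) auto

lemma psi_nonneg:
  assumes "0 \<le> g y"
  shows "0 \<le> psi X Y c g x y"
  unfolding psi_def using assms by simp

text \<open>A product of two non-increasing functions need not be non-increasing; it is here because the
  positive part and the smoothed delta are both non-negative.\<close>

lemma quadrature_term_antimono:
  assumes "0 \<le> hX" and "0 \<le> hY" and "0 \<le> g y" and "p \<le> p'" and "q \<le> q'"
  shows "max (D_xx hX (a' - p') a' (a' - q') + b) 0 * psi X Y c g x y
           * delta_h X Y c hX hY x y (a' - p') a' (a' - q')
       \<le> max (D_xx hX (a - p) a (a - q) + b) 0 * psi X Y c g x y
           * delta_h X Y c hX hY x y (a - p) a (a - q)"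
proof (rule mult_mono)
  have "max (D_xx hX (a' - p') a' (a' - q') + b) 0 \<le> max (D_xx hX (a - p) a (a - q) + b) 0"
    using D_xx_antimono[OF assms(4,5)] by (intro max.mono add_right_mono order_refl)
  then show "max (D_xx hX (a' - p') a' (a' - q') + b) 0 * psi X Y c g x y
      \<le> max (D_xx hX (a - p) a (a - q) + b) 0 * psi X Y c g x y"
    using psi_nonneg[of g, OF assms(3)] by (rule mult_right_mono)
  show "delta_h X Y c hX hY x y (a' - p') a' (a' - q') \<le> delta_h X Y c hX hY x y (a - p) a (a - q)"
    using assms by (intro delta_h_antimono)
  show "0 \<le> max (D_xx hX (a - p) a (a - q) + b) 0 * psi X Y c g x y"
    using psi_nonneg[of g, OF assms(3)] by simp
  show "0 \<le> delta_h X Y c hX hY x y (a' - p') a' (a' - q')"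
    using assms(2) by (rule delta_h_nonneg)
qed

lemma F_interior_mono:
  assumes "0 \<le> hX" and "0 \<le> hY"
    and g: "\<And>j k. j \<le> M \<Longrightarrow> k \<le> M \<Longrightarrow> 0 \<le> g (y_grid y0 hY j k)"
    and "a \<le> a'" and "p \<le> p'" and "q \<le> q'"
  shows "F_interior X Y c f g x0 y0 hX hY M i a p q
       \<le> F_interior X Y c f g x0 y0 hX hY M i a' p' q'"
proof -
  have "(hY\<^sup>2 + hX / hY) * a \<le> (hY\<^sup>2 + hX / hY) * a'"
    using assms by (intro mult_left_mono) auto
  then show ?thesis
    unfolding F_interior_def Let_def mult_minus_left
    using assms
    by (intro add_mono le_imp_neg_le mult_left_mono sum_mono quadrature_term_antimono) auto
qed

lemma F_left_mono:
  assumes "0 \<le> hX" and "a \<le> a'" and "p \<le> p'"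
  shows "F_left X Y c x0 hX a p \<le> F_left X Y c x0 hX a' p'"
  using divide_right_mono[OF assms(3,1)] mult_left_mono[OF assms(2,1)]
  by (simp add: F_left_def)

lemma F_right_mono:
  assumes "0 \<le> hX" and "a \<le> a'" and "p \<le> p'"
  shows "F_right X Y c x0 hX N a p \<le> F_right X Y c x0 hX N a' p'"
  using divide_right_mono[OF assms(3,1)] mult_left_mono[OF assms(2,1)]
  by (simp add: F_right_def)

lemma monotone_schemeI:
  assumes "\<And>i a a' d d'. i \<in> I \<Longrightarrow> a \<le> a' \<Longrightarrow> d \<le> d' \<Longrightarrow> F i a d \<le> F i a' d'"
  shows "monotone_scheme I F"
  unfolding monotone_scheme_def mono_def by (auto intro!: assms simp: le_fun_def)

lemma y_grid_in_square:
  assumes "y0 \<le> ymax" and hY: "hY = (ymax - y0) / real M" and "j \<le> M" and "k \<le> M"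
  shows "y_grid y0 hY j k \<in> {y0..ymax} \<times> {y0..ymax}"
proof -
  have "0 \<le> hY"
    using assms by simp
  have "real l * hY \<le> ymax - y0" if "l \<le> M" for l
  proof (cases "M = 0")
    \<comment> \<open>Here \<open>hY = 0\<close>, by the convention for division by zero.\<close>
    case True
    then show ?thesis using assms by simp
  next
    case False
    then show ?thesis
      using mult_right_mono[of "real l" "real M" hY] that \<open>0 \<le> hY\<close> by (simp add: hY)
  qed
  then show ?thesis
    using assms(3,4) \<open>0 \<le> hY\<close> by (force simp: y_grid_def algebra_simps)
qed

theorem lemma8:
  fixes x0 xmax y0 ymax hX hY :: real
    and X :: "real set" and Y :: "(real \<times> real) set"
    and c :: "real \<times> (real \<times> real) \<Rightarrow> real"
    and f u :: "real \<Rightarrow> real" and g :: "real \<times> real \<Rightarrow> real"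
    and N M :: nat
  assumes "x0 < xmax" and "y0 < ymax"
    and X: "X = {x0..xmax}" and Y: "Y = {y0..ymax} \<times> {y0..ymax}"
    and mass: "(LINT x:X|lborel. f x) = (LINT y:Y|lborel. g y)"
    and H1: "Ck_on 4 (X \<times> Y) c"
    and H2: "\<exists>m>0. \<forall>x\<in>X. \<forall>y\<in>Y.
               m \<le> sqrt ((c_xy1 X Y c (x, y))\<^sup>2 + (c_xy2 X Y c (x, y))\<^sup>2)"
    and H3_f: "Ck_on 0 X f" "\<exists>m>0. \<exists>B. \<forall>x\<in>X. m \<le> f x \<and> f x \<le> B"
    and H3_g: "Ck_on 2 Y g" "\<exists>m>0. \<exists>B. \<forall>y\<in>Y. m \<le> g y \<and> g y \<le> B"
    and H4: "solves_equation X Y c f g u" "Ck_on 2 (interior X) u" "Ck_on 1 X u"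
    and "N \<ge> 1" and "M \<ge> 1"
    and hX: "hX = (xmax - x0) / real N" and hY: "hY = (ymax - y0) / real M"
  shows "monotone_scheme {0..N} (F_scheme X Y c f g x0 y0 hX hY N M) \<and>
    (\<forall>i\<in>{1..N - 1}.
       (\<forall>p q. mono (\<lambda>a. F_interior X Y c f g x0 y0 hX hY M i a p q)) \<and>
       (\<forall>a q. mono (\<lambda>p. F_interior X Y c f g x0 y0 hX hY M i a p q)) \<and>
       (\<forall>a p. mono (\<lambda>q. F_interior X Y c f g x0 y0 hX hY M i a p q))) \<and>
    (\<forall>p. mono (\<lambda>a. F_left X Y c x0 hX a p)) \<and>
    (\<forall>a. mono (\<lambda>p. F_left X Y c x0 hX a p)) \<and>
    (\<forall>p. mono (\<lambda>a. F_right X Y c x0 hX N a p)) \<and>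
    (\<forall>a. mono (\<lambda>p. F_right X Y c x0 hX N a p))"
proof -
  have "0 \<le> hX" "0 \<le> hY"
    using \<open>x0 < xmax\<close> \<open>y0 < ymax\<close> by (auto simp: hX hY)
  have g: "0 \<le> g (y_grid y0 hY j k)" if "j \<le> M" "k \<le> M" for j k
  proof -
    have "y_grid y0 hY j k \<in> Y"
      using y_grid_in_square[OF _ hY that] \<open>y0 < ymax\<close> by (simp add: Y)
    then show ?thesis
      using H3_g(2) by force
  qed
  note interior = F_interior_mono[where g = g and ?y0.0 = y0, OF \<open>0 \<le> hX\<close> \<open>0 \<le> hY\<close> g]
  note left = F_left_mono[OF \<open>0 \<le> hX\<close>]
  note right = F_right_mono[OF \<open>0 \<le> hX\<close>]
  have "monotone_scheme {0..N} (F_scheme X Y c f g x0 y0 hX hY N M)"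
    by (rule monotone_schemeI)
      (auto simp: F_scheme_def le_fun_def intro!: interior left right)
  then show ?thesis
    by (auto simp: mono_def intro!: interior left right)
qed

end
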